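(* For all integers $k,\ell\ge1$ and every orientation $\vec{P_k}$ of the path on $k$ vertices and every orientation $\vec{P_\ell}$ of the path on $\ell$ vertices, $\chi_o(\vec{P_k}\,\square\,\vec{P_\ell})\le 3$.
   Context: An oriented graph is a finite digraph with no loops, no multiple arcs and no pair of opposite arcs; an orientation of an undirected graph gives each edge one of its two directions. A homomorphism between oriented graphs is a vertex map sending arcs to arcs. The oriented chromatic number $\chi_o(\vec G)$ is the smallest order of an oriented graph $\vec T$ with a homomorphism $\vec G\to\vec T$. The Cartesian product $\vec G\,\square\,\vec H$ has vertex set $V(\vec G)\times V(\vec H)$, and $([u,v],[u',v'])$ is an arc iff either $u=u'$ and $(v,v')\in E(\vec H)$, or $v=v'$ and $(u,u')\in E(\vec G)$. *)

theory Defs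
  imports "Graph_Theory.Pair_Digraph"
begin

locale oriented_graph = pair_digraph +
  assumes no_opposite_arcs: "(u, v) \<in> parcs G \<Longrightarrow> (v, u) \<notin> parcs G"

definition digraph_hom ::
    "'a pair_pre_digraph \<Rightarrow> 'b pair_pre_digraph \<Rightarrow> ('a \<Rightarrow> 'b) \<Rightarrow> bool" where
  "digraph_hom G H f \<longleftrightarrow>
     (\<forall>v \<in> pverts G. f v \<in> pverts H) \<and>
     (\<forall>(u, v) \<in> parcs G. (f u, f v) \<in> parcs H)"

text \<open>
  Targets are taken on vertices of type \<^typ>\<open>nat\<close>, since HOL cannot quantify over types inside
  a definition; every finite target has a copy of this form. The minimum is over a nonempty set
  whenever the argument is an oriented graph. Both facts are proved below.
\<close>
definition oriented_chromatic_number :: "'a pair_pre_digraph \<Rightarrow> nat" where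
  "oriented_chromatic_number G =
     (LEAST n. \<exists>T :: nat pair_pre_digraph. oriented_graph T \<and> card (pverts T) = n \<and>
        (\<exists>f. digraph_hom G T f))"

definition cartesian_product ::
    "'a pair_pre_digraph \<Rightarrow> 'b pair_pre_digraph \<Rightarrow> ('a \<times> 'b) pair_pre_digraph"
    (infixr \<open>\<box>\<close> 80) where
  "G \<box> H =
     \<lparr> pverts = pverts G \<times> pverts H,
       parcs = {((u, v), (u', v')) | u v u' v'.
         (u = u' \<and> u \<in> pverts G \<and> (v, v') \<in> parcs H) \<or>
         (v = v' \<and> v \<in> pverts H \<and> (u, u') \<in> parcs G)} \<rparr>"

text \<open>
  Undirected graphs are symmetric digraphs (\<^locale>\<open>pair_graph\<close>), so an edge of \<open>G\<close> is a pair of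
  opposite arcs, of which an orientation keeps exactly one.
\<close>
definition orientation_of :: "'a pair_pre_digraph \<Rightarrow> 'a pair_pre_digraph \<Rightarrow> bool" where
  "orientation_of G D \<longleftrightarrow>
     pverts D = pverts G \<and> parcs D \<subseteq> parcs G \<and>
     (\<forall>(u, v) \<in> parcs G. (u, v) \<in> parcs D \<longleftrightarrow> (v, u) \<notin> parcs D)"

definition path_graph :: "nat \<Rightarrow> nat pair_pre_digraph" where
  "path_graph k =
     \<lparr> pverts = {..<k},
       parcs = {(i, j). i < k \<and> j < k \<and> (j = Suc i \<or> i = Suc j)} \<rparr>"

lemma pair_graph_path_graph: "pair_graph (path_graph k)"
proof -
  have "finite (parcs (path_graph k))"
    by (rule finite_subset[of _ "{..<k} \<times> {..<k}"]) (auto simp: path_graph_def)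
  then show ?thesis
    by unfold_locales (auto simp: path_graph_def symmetric_def sym_def)
qed

lemma oriented_graph_orientation:
  assumes "pair_graph G" and D: "orientation_of G D"
  shows "oriented_graph D"
proof -
  interpret pair_graph G by fact
  have V: "pverts D = pverts G" and A: "parcs D \<subseteq> parcs G"
    and X: "\<And>u v. (u, v) \<in> parcs G \<Longrightarrow> (u, v) \<in> parcs D \<longleftrightarrow> (v, u) \<notin> parcs D"
    using D by (auto simp: orientation_of_def)
  show ?thesis
  proof
    show "finite (parcs D)" using A finite_subset pair_finite_arcs by blast
  next
    fix u v assume "(u, v) \<in> parcs D"
    then show "(v, u) \<notin> parcs D" using A X by blast
  next
    fix e assume "e \<in> parcs D"
    then have "e \<in> parcs G" using A by blast
    then show "fst e \<in> pverts D" "snd e \<in> pverts D" "fst e \<noteq> snd e"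
      using V arc_fst_in_verts arc_snd_in_verts pair_no_loops by simp_all
  next
    show "finite (pverts D)" using V pair_finite_verts by simp
  qed
qed

lemma oriented_graph_cartesian_product:
  assumes "oriented_graph G" and "oriented_graph H"
  shows "oriented_graph (G \<box> H)"
proof -
  interpret G: oriented_graph G by fact
  interpret H: oriented_graph H by fact
  have sub: "parcs (G \<box> H) \<subseteq> (pverts G \<times> pverts H) \<times> (pverts G \<times> pverts H)"
    by (auto simp: cartesian_product_def dest: G.in_arcsD1 G.in_arcsD2 H.in_arcsD1 H.in_arcsD2)
  have V: "pverts (G \<box> H) = pverts G \<times> pverts H"
    by (simp add: cartesian_product_def)
  show ?thesis
  proof
    show "finite (parcs (G \<box> H))"
      by (rule finite_subset[OF sub]) simp
    show "finite (pverts (G \<box> H))"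
      by (simp add: V)
  next
    fix e assume "e \<in> parcs (G \<box> H)"
    then show "fst e \<in> pverts (G \<box> H)" "snd e \<in> pverts (G \<box> H)"
      using sub V by auto
    show "fst e \<noteq> snd e"
      using \<open>e \<in> parcs (G \<box> H)\<close>
      by (auto simp: cartesian_product_def dest: G.pair_no_loops H.pair_no_loops)
  next
    fix x y assume "(x, y) \<in> parcs (G \<box> H)"
    then show "(y, x) \<notin> parcs (G \<box> H)"
      by (auto simp: cartesian_product_def
          dest: G.pair_no_loops H.pair_no_loops G.no_opposite_arcs H.no_opposite_arcs)
  qed
qed

lemma nat_copy:
  fixes T :: "'b pair_pre_digraph"
  assumes "oriented_graph T" and f: "digraph_hom G T f"
  shows "\<exists>T' :: nat pair_pre_digraph. oriented_graph T' \<and> card (pverts T') = card (pverts T) \<and>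
    (\<exists>g. digraph_hom G T' g)"
proof -
  interpret oriented_graph T by fact
  obtain h :: "'b \<Rightarrow> nat" where h: "inj_on h (pverts T)"
    using finite_imp_inj_to_nat_seg[OF pair_finite_verts] by blast
  define T' where "T' = \<lparr> pverts = h ` pverts T, parcs = map_prod h h ` parcs T \<rparr>"
  have "oriented_graph T'"
  proof
    fix x y assume "(x, y) \<in> parcs T'"
    then obtain u v where uv: "(u, v) \<in> parcs T" "x = h u" "y = h v"
      by (auto simp: T'_def)
    show "(y, x) \<notin> parcs T'"
    proof
      assume "(y, x) \<in> parcs T'"
      then obtain u' v' where uv': "(v', u') \<in> parcs T" "x = h u'" "y = h v'"
        by (auto simp: T'_def)
      have "u' = u" "v' = v"
        using uv uv' inj_onD[OF h] in_arcsD1 in_arcsD2 by simp_all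
      then show False
        using uv uv' no_opposite_arcs by blast
    qed
  next
    fix e assume "e \<in> parcs T'"
    then obtain u v where uv: "(u, v) \<in> parcs T" "e = (h u, h v)"
      by (auto simp: T'_def)
    then have "u \<noteq> v" using pair_no_loops by fastforce
    then show "fst e \<noteq> snd e"
      using uv inj_onD[OF h, of u v] in_arcsD1 in_arcsD2 by auto
  qed (auto simp: T'_def dest: in_arcsD1 in_arcsD2)
  moreover have "card (pverts T') = card (pverts T)"
    by (simp add: T'_def card_image h)
  moreover have "digraph_hom G T' (h \<circ> f)"
    using f by (force simp: digraph_hom_def T'_def)
  ultimately show ?thesis by blast
qed

lemma oriented_chromatic_number_le:
  assumes "oriented_graph T" and "digraph_hom G T f"
  shows "oriented_chromatic_number G \<le> card (pverts T)"
  unfolding oriented_chromatic_number_def by (rule Least_le) (rule nat_copy[OF assms])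

lemma oriented_chromatic_number_attained:
  assumes "oriented_graph G"
  shows "\<exists>T :: nat pair_pre_digraph. oriented_graph T \<and>
    card (pverts T) = oriented_chromatic_number G \<and> (\<exists>f. digraph_hom G T f)"
proof -
  have "digraph_hom G G id" by (auto simp: digraph_hom_def)
  from LeastI[where P = "\<lambda>n. \<exists>T :: nat pair_pre_digraph. oriented_graph T \<and>
      card (pverts T) = n \<and> (\<exists>f. digraph_hom G T f)", OF nat_copy[OF assms this]]
  show ?thesis unfolding oriented_chromatic_number_def .
qed

end

theory Submission
  imports Defs
begin

text \<open>
  Along an oriented path, counting forward arcs minus backward arcs yields an integer height that
  increases by exactly 1 on every arc. The sum of the heights of the two coordinates has the same
  property on the Cartesian product, so reducing it modulo 3 is a homomorphism to the directed
  3-cycle.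
\<close>

text \<open>The vertices are the residues that \<open>mod 3\<close> returns on integers, so a height
  reduced modulo 3 is already a vertex.\<close>

definition directed_triangle :: "int pair_pre_digraph" where
  "directed_triangle = \<lparr> pverts = {0, 1, 2}, parcs = {(0, 1), (1, 2), (2, 0)} \<rparr>"

lemma oriented_graph_directed_triangle: "oriented_graph directed_triangle"
  by unfold_locales (auto simp: directed_triangle_def)

text \<open>Equivalently, a homomorphism to the two-way infinite directed path on the
  integers.\<close>

definition height_function :: "'a pair_pre_digraph \<Rightarrow> ('a \<Rightarrow> int) \<Rightarrow> bool" where
  "height_function G h \<longleftrightarrow> (\<forall>(u, v) \<in> parcs G. h v = h u + 1)"

lemma mod_3_arc_directed_triangle: "(x mod 3, (x + 1) mod 3) \<in> parcs directed_triangle"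
proof -
  have "x mod 3 = 0 \<and> (x + 1) mod 3 = 1 \<or> x mod 3 = 1 \<and> (x + 1) mod 3 = 2 \<or>
      x mod 3 = 2 \<and> (x + 1) mod 3 = 0"
    by presburger
  then show ?thesis
    by (auto simp: directed_triangle_def)
qed

lemma oriented_chromatic_number_le_3:
  assumes "height_function G h"
  shows "oriented_chromatic_number G \<le> 3"
proof -
  have "x mod 3 \<in> pverts directed_triangle" for x
    unfolding directed_triangle_def by simp presburger
  moreover have "(h u mod 3, h v mod 3) \<in> parcs directed_triangle" if "(u, v) \<in> parcs G" for u v
    using assms that mod_3_arc_directed_triangle[of "h u"] by (auto simp: height_function_def)
  ultimately have "digraph_hom G directed_triangle (\<lambda>v. h v mod 3)"
    by (auto simp: digraph_hom_def)
  from oriented_chromatic_number_le[OF oriented_graph_directed_triangle this] show ?thesis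
    by (simp add: directed_triangle_def)
qed

text \<open>An arc of the product moves one coordinate along an arc of its factor and fixes the
  other, so exactly one summand rises by 1.\<close>

lemma height_function_cartesian_product:
  assumes "height_function G g" and "height_function H h"
  shows "height_function (G \<box> H) (\<lambda>(u, v). g u + h v)"
  using assms by (fastforce simp: height_function_def cartesian_product_def)

text \<open>Consecutive vertices differ by a single summand, whose sign records the direction of the
  arc between them. The value -1 at \<open>j\<close> with \<open>Suc j \<ge> k\<close> enters no
  height of a vertex of the path.\<close>

lemma height_function_oriented_path:
  assumes "orientation_of (path_graph k) P"
  shows "height_function P (\<lambda>i. \<Sum>j<i. if (j, Suc j) \<in> parcs P then 1 else - 1)"
  unfolding height_function_def
proof clarify
  fix u v assume uv: "(u, v) \<in> parcs P"
  then have arc: "(u, v) \<in> parcs (path_graph k)"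
    using assms by (auto simp: orientation_of_def)
  \<comment> \<open>For a backward arc, \<open>u = Suc v\<close>, the summand at \<open>v\<close>
    tests \<open>(v, u)\<close>; its absence makes that summand -1.\<close>
  then have "(v, u) \<notin> parcs P"
    using assms uv by (auto simp: orientation_of_def)
  moreover from arc have "v = Suc u \<or> u = Suc v"
    by (auto simp: path_graph_def)
  ultimately show "(\<Sum>j<v. if (j, Suc j) \<in> parcs P then 1 else - 1) =
      (\<Sum>j<u. if (j, Suc j) \<in> parcs P then 1 else - 1) + (1 :: int)"
    using uv by auto
qed

theorem theorem11:
  fixes k l :: nat and P Q :: "nat pair_pre_digraph"
  assumes "k \<ge> 1" and "l \<ge> 1"
    and "orientation_of (path_graph k) P"
    and "orientation_of (path_graph l) Q"
  shows "oriented_chromatic_number (P \<box> Q) \<le> 3"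
  by (rule oriented_chromatic_number_le_3[OF height_function_cartesian_product[OF
      height_function_oriented_path[OF assms(3)] height_function_oriented_path[OF assms(4)]]])

end
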